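(* Suppose $\kappa$ is a singular cardinal, $\lambda>\kappa$ is a regular cardinal, $(\lambda^{+},\lambda)\twoheadrightarrow(\kappa^{+},\kappa)$, and $\mu$ is a cardinal with $\operatorname{cf}(\kappa)\le\mu<\kappa$. Then $(\kappa^{+},\kappa)\not\twoheadrightarrow_{\operatorname{cf}(\kappa)}(\mu^{+},\mu)$. Consequently, if moreover $\mu^{<\operatorname{cf}(\kappa)}=\mu$, then $(\kappa^{+},\kappa)\not\twoheadrightarrow(\mu^{+},\mu)$.
   Context: $(\kappa_1,\kappa_0)\twoheadrightarrow(\mu_1,\mu_0)$ means: for every structure $\mathfrak A$ with universe $\kappa_1$ in a countable language there is a substructure $\mathfrak B$ with $|\mathfrak B|=\mu_1$ and $|\mathfrak B\cap\kappa_0|=\mu_0$. $(\kappa_1,\kappa_0)\twoheadrightarrow_\nu(\mu_1,\mu_0)$ means the same but additionally requiring $\nu\subseteq\mathfrak B$. *)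

theory Defs
  imports Main
begin

unbundle cardinal_syntax

text \<open>
  A cardinal is a cardinal order \<^term>\<open>r\<close> (\<^term>\<open>Card_order r\<close>), taken up to \<open>=o\<close>.
  The elements of \<^term>\<open>Field r\<close> play the role of the ordinals below \<^term>\<open>r\<close>: the point
  \<^term>\<open>x\<close> stands for the order type of the initial segment \<^term>\<open>underS r x\<close>.
\<close>


subsection \<open>Cofinality and weak powers\<close>

text \<open>The least cardinality of a cofinal set. The library's \<^term>\<open>cofinal K r\<close> asks for
  strictly larger elements, which for infinite cardinals is the usual notion.\<close>

definition cof :: "'a rel \<Rightarrow> 'a rel" where
  "cof r = |SOME K. K \<subseteq> Field r \<and> cofinal K r \<and>
              (\<forall>K'. K' \<subseteq> Field r \<and> cofinal K' r \<longrightarrow> |K| \<le>o |K'| )|"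

definition singularCard :: "'a rel \<Rightarrow> bool" where
  "singularCard r \<longleftrightarrow> Card_order r \<and> cinfinite r \<and> cof r <o r"

text \<open>The weak power \<open>r\<^bsup><s\<^esup>\<close>: the cardinality of the set of all sequences in \<^term>\<open>r\<close> whose
  length is an ordinal below \<^term>\<open>s\<close>. Sequences are tagged with their length, since
  \<^const>\<open>Func\<close> represents partial functions by padding with \<^const>\<open>undefined\<close>.\<close>

definition weak_cexp :: "'a rel \<Rightarrow> 'b rel \<Rightarrow> ('b \<times> ('b \<Rightarrow> 'a)) rel" where
  "weak_cexp r s = |SIGMA a : Field s. Func (underS s a) (Field r)|"


subsection \<open>First-order structures in a countable language\<close>

text \<open>The symbols of a countable language are taken to be natural numbers, any set of which
  may occur. Constants are function symbols of arity 0.\<close>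

record countable_language =
  fun_syms :: "nat set"
  rel_syms :: "nat set"
  fun_arity :: "nat \<Rightarrow> nat"
  rel_arity :: "nat \<Rightarrow> nat"

record 'a fo_structure =
  universe :: "'a set"
  fun_interp :: "nat \<Rightarrow> 'a list \<Rightarrow> 'a"
  rel_interp :: "nat \<Rightarrow> 'a list \<Rightarrow> bool"

definition tuples :: "'a set \<Rightarrow> nat \<Rightarrow> 'a list set" where
  "tuples A n = {xs. set xs \<subseteq> A \<and> length xs = n}"

definition is_structure :: "countable_language \<Rightarrow> 'a fo_structure \<Rightarrow> bool" where
  "is_structure L A \<longleftrightarrow> universe A \<noteq> {} \<and>
     (\<forall>f \<in> fun_syms L. \<forall>xs \<in> tuples (universe A) (fun_arity L f). fun_interp A f xs \<in> universe A)"

definition is_substructure :: "countable_language \<Rightarrow> 'a fo_structure \<Rightarrow> 'a fo_structure \<Rightarrow> bool" where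
  "is_substructure L B A \<longleftrightarrow> is_structure L B \<and> universe B \<subseteq> universe A \<and>
     (\<forall>f \<in> fun_syms L. \<forall>xs \<in> tuples (universe B) (fun_arity L f).
        fun_interp B f xs = fun_interp A f xs) \<and>
     (\<forall>R \<in> rel_syms L. \<forall>xs \<in> tuples (universe B) (rel_arity L R).
        rel_interp B R xs \<longleftrightarrow> rel_interp A R xs)"


subsection \<open>Chang's Conjecture\<close>

text \<open>The set of ordinals in \<^term>\<open>r\<close> that are below \<^term>\<open>s\<close>. For \<open>s \<le>o r\<close> this is the copy of
  \<^term>\<open>s\<close> as an initial segment of \<^term>\<open>r\<close>; it replaces the inclusion of von Neumann ordinals
  (see \<open>seg_ordIso\<close> below).\<close>

definition seg :: "'a rel \<Rightarrow> 'b rel \<Rightarrow> 'a set" where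
  "seg r s = {x \<in> Field r. Restr r (underS r x) <o s}"

text \<open>\<open>(\<kappa>\<^sub>1, \<kappa>\<^sub>0) \<Zsurj> (\<mu>\<^sub>1, \<mu>\<^sub>0)\<close>\<close>

definition chang :: "'a rel \<Rightarrow> 'b rel \<Rightarrow> 'c rel \<Rightarrow> 'd rel \<Rightarrow> bool" where
  "chang \<kappa>\<^sub>1 \<kappa>\<^sub>0 \<mu>\<^sub>1 \<mu>\<^sub>0 \<longleftrightarrow>
     (\<forall>L (A :: 'a fo_structure). is_structure L A \<and> universe A = Field \<kappa>\<^sub>1 \<longrightarrow>
        (\<exists>B. is_substructure L B A \<and> |universe B| =o \<mu>\<^sub>1 \<and> |universe B \<inter> seg \<kappa>\<^sub>1 \<kappa>\<^sub>0| =o \<mu>\<^sub>0))"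

text \<open>\<open>(\<kappa>\<^sub>1, \<kappa>\<^sub>0) \<Zsurj>\<^sub>\<nu> (\<mu>\<^sub>1, \<mu>\<^sub>0)\<close>\<close>

definition chang_over :: "'e rel \<Rightarrow> 'a rel \<Rightarrow> 'b rel \<Rightarrow> 'c rel \<Rightarrow> 'd rel \<Rightarrow> bool" where
  "chang_over \<nu> \<kappa>\<^sub>1 \<kappa>\<^sub>0 \<mu>\<^sub>1 \<mu>\<^sub>0 \<longleftrightarrow>
     (\<forall>L (A :: 'a fo_structure). is_structure L A \<and> universe A = Field \<kappa>\<^sub>1 \<longrightarrow>
        (\<exists>B. is_substructure L B A \<and> |universe B| =o \<mu>\<^sub>1 \<and> |universe B \<inter> seg \<kappa>\<^sub>1 \<kappa>\<^sub>0| =o \<mu>\<^sub>0 \<and>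
             seg \<kappa>\<^sub>1 \<nu> \<subseteq> universe B))"


subsection \<open>Adequacy of the encodings\<close>

lemma seg_ordIso:
  assumes r: "Well_order r" and s: "Well_order s" and le: "s \<le>o r"
  shows "Restr r (seg r s) =o s"
proof (cases "s =o r")
  case True
  have "seg r s = Field r"
  proof -
    have "Restr r (underS r x) <o s" if "x \<in> Field r" for x
    proof -
      have "Restr r (underS r x) <o r" using underS_Restr_ordLess[OF r] that by blast
      then show ?thesis using True ordIso_symmetric ordLess_ordIso_trans by blast
    qed
    then show ?thesis unfolding seg_def by blast
  qed
  then have "Restr r (seg r s) = r" by (simp add: Restr_Field)
  then show ?thesis using True ordIso_symmetric by metis
next
  case False
  then have "s <o r" using le ordLeq_iff_ordLess_or_ordIso by blast
  then obtain a where a: "a \<in> Field r" "s =o Restr r (underS r a)"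
    using ordLess_iff_ordIso_Restr[OF r s] by blast
  have wo: "wo_rel r" using r by (simp add: wo_rel_def)
  have of: "wo_rel.ofilter r (underS r x)" for x
    using wo by (simp add: wo_rel.underS_ofilter)
  have "Restr r (underS r x) <o s \<longleftrightarrow> x \<in> underS r a" if x: "x \<in> Field r" for x
  proof -
    have "Restr r (underS r x) <o s \<longleftrightarrow> Restr r (underS r x) <o Restr r (underS r a)"
      using a(2) ordIso_symmetric[OF a(2)]
        ordLess_ordIso_trans[of "Restr r (underS r x)" s "Restr r (underS r a)"]
        ordLess_ordIso_trans[of "Restr r (underS r x)" "Restr r (underS r a)" s]
      by metis
    also have "\<dots> \<longleftrightarrow> underS r x \<subset> underS r a"
      using ofilter_subset_ordLess[OF r of[of x] of[of a]] by metis
    also have "\<dots> \<longleftrightarrow> x \<in> underS r a"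
    proof
      assume "x \<in> underS r a"
      then have "underS r x \<subseteq> underS r a"
        using r underS_incr[of r x a] unfolding underS_def
        by (auto simp: order_on_defs dest: transD antisymD)
      moreover have "x \<notin> underS r x" by (simp add: underS_def)
      ultimately show "underS r x \<subset> underS r a" using \<open>x \<in> underS r a\<close> by blast
    next
      assume sub: "underS r x \<subset> underS r a"
      have "(x, a) \<in> r \<or> (a, x) \<in> r"
        using wo_rel.TOTALS[OF wo] x a(1) by blast
      moreover have "\<not> underS r a \<subseteq> underS r x" using sub by blast
      moreover have "underS r a \<subseteq> underS r x" if "(a, x) \<in> r"
        using r that unfolding underS_def
        by (auto simp: order_on_defs dest: transD antisymD)
      ultimately show "x \<in> underS r a" unfolding underS_def by blast
    qed
    finally show ?thesis .
  qed
  moreover have "underS r a \<subseteq> Field r" by (auto simp: underS_def Field_def)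
  ultimately have "seg r s = underS r a" unfolding seg_def by blast
  then show ?thesis using a(2) ordIso_symmetric by metis
qed

lemma cof_eq:
  assumes r: "Card_order r" "cinfinite r"
  obtains K where "K \<subseteq> Field r" "cofinal K r" "cof r = |K|"
    "\<And>K'. K' \<subseteq> Field r \<Longrightarrow> cofinal K' r \<Longrightarrow> |K| \<le>o |K'|"
proof -
  let ?C = "{K. K \<subseteq> Field r \<and> cofinal K r}"
  have inf: "\<not> finite (Field r)" using r(2) unfolding cinfinite_def .
  have "cofinal (Field r) r"
    unfolding cofinal_def using infinite_Card_order_limit[OF r(1) inf] by blast
  then have "card_of ` ?C \<noteq> {}" by blast
  moreover have "\<forall>p \<in> card_of ` ?C. Card_order p" using card_of_Card_order by blast
  ultimately have "\<exists>p \<in> card_of ` ?C. \<forall>q \<in> card_of ` ?C. p \<le>o q"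
    by (rule exists_minim_Card_order)
  then have "\<exists>K. K \<subseteq> Field r \<and> cofinal K r \<and>
      (\<forall>K'. K' \<subseteq> Field r \<and> cofinal K' r \<longrightarrow> |K| \<le>o |K'| )"
    by auto
  from someI_ex[OF this] show thesis
    by (elim conjE) (rule that[OF _ _ cof_def]; simp)
qed

lemma regularCard_iff_cof:
  assumes r: "Card_order r" "cinfinite r"
  shows "regularCard r \<longleftrightarrow> cof r =o r"
proof -
  obtain K where K: "K \<subseteq> Field r" "cofinal K r" "cof r = |K|"
    "\<And>K'. K' \<subseteq> Field r \<Longrightarrow> cofinal K' r \<Longrightarrow> |K| \<le>o |K'|"
    using cof_eq[OF r] by blast
  have "|K'| =o r" if "|K| =o r" "K' \<subseteq> Field r" "cofinal K' r" for K'
  proof -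
    have "r \<le>o |K'|" using K(4)[OF that(2,3)] that(1) ordIso_ordLeq_trans ordIso_symmetric by blast
    moreover have "|K'| \<le>o r"
      using card_of_mono1[OF that(2)] card_of_Field_ordIso[OF r(1)] ordLeq_ordIso_trans by blast
    ultimately show ?thesis using ordIso_iff_ordLeq by blast
  qed
  then show ?thesis using K unfolding regularCard_def by metis
qed

lemma singularCard_iff_not_regularCard:
  assumes r: "Card_order r" "cinfinite r"
  shows "singularCard r \<longleftrightarrow> \<not> regularCard r"
proof -
  obtain K where K: "K \<subseteq> Field r" "cof r = |K|" using r by (rule cof_eq)
  have "cof r \<le>o r"
    unfolding K(2)
    by (rule ordLeq_ordIso_trans[OF card_of_mono1[OF K(1)] card_of_Field_ordIso[OF r(1)]])
  then show ?thesis
    unfolding singularCard_def regularCard_iff_cof[OF r]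
    using r ordLeq_iff_ordLess_or_ordIso[of "cof r" r] not_ordLess_ordIso[of "cof r" r] by metis
qed

end

theory Submission
  imports Defs
begin

text \<open>
  Since \<open>\<Lambda>\<close> is regular, there are \<open>\<Lambda>\<^sup>+\<close> functions \<open>\<Lambda> \<rightarrow> \<Lambda>\<close> such that the graphs of any \<open>\<Lambda>\<close> of them become
  disjoint after discarding a bounded part of each. A substructure of size \<open>\<kappa>\<^sup>+\<close> that meets \<open>\<Lambda>\<close> in a
  set \<open>D\<close> of size \<open>\<kappa>\<close> and is closed under these functions and their disjointifying bounds reflects
  this to \<open>\<kappa>\<^sup>+\<close> functions \<open>D \<rightarrow> D\<close>. By a pigeonhole argument \<open>D\<close> has cofinality \<open>cf \<kappa>\<close>, so one gets
  \<open>\<kappa>\<^sup>+\<close> functions \<open>g\<^sub>\<alpha> : cf \<kappa> \<rightarrow> \<kappa>\<close>, any \<open>\<kappa>\<close> of which can be disjointified.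

  Let \<open>M \<subseteq> \<kappa>\<^sup>+\<close> be closed under \<open>(\<alpha>, i) \<mapsto> g\<^sub>\<alpha>(i)\<close> and under a function picking a point where \<open>g\<^sub>\<alpha>\<close> and
  \<open>g\<^sub>\<beta>\<close> differ, with \<open>|M| = \<mu>\<^sup>+\<close> and \<open>|M \<inter> \<kappa>| = \<mu>\<close>. If \<open>M\<close> is cofinal in \<open>cf \<kappa>\<close>, then choosing a point in
  each of the disjoint graphs injects \<open>M\<close> into \<open>cf \<kappa> \<times> (M \<inter> \<kappa>)\<close>, which has only \<open>\<mu>\<close> elements.
  Otherwise \<open>\<alpha> \<mapsto> g\<^sub>\<alpha>\<close>, restricted to \<open>M \<inter> cf \<kappa>\<close>, injects \<open>M\<close> into the functions from a bounded subset of
  \<open>cf \<kappa>\<close> to \<open>M \<inter> \<kappa>\<close>, so that \<open>\<mu>\<^bsup><cf \<kappa>\<^esup> > \<mu>\<close>.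
\<close>

subsection \<open>Cardinals\<close>

lemma card_of_ordLeqI:
  assumes "inj_on f A" "f ` A \<subseteq> B"
  shows "|A| \<le>o |B|"
  using assms card_of_ordLeq[of A B] by metis

lemma cinfinite_mono:
  assumes "cinfinite r" "Card_order r" "Card_order s" "r \<le>o s"
  shows "cinfinite s"
  using assms Card_order_iff_ordLeq_card_of card_of_mono2[OF assms(4)] card_of_ordLeq_infinite
  unfolding cinfinite_def by blast

lemma card_of_finite_ordLess:
  assumes "finite A" "Card_order r" "cinfinite r"
  shows "|A| <o r"
  by (rule finite_ordLess_infinite[OF card_of_Well_order])
    (use assms in \<open>auto simp: card_order_on_def cinfinite_def Field_card_of\<close>)

lemma Card_order_bij:
  assumes "Card_order r" "|A| =o r"
  obtains p where "bij_betw p (Field r) A"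
proof -
  have "|Field r| =o |A|"
    using assms card_of_Field_ordIso ordIso_symmetric ordIso_transitive by blast
  then show thesis using that card_of_ordIso by blast
qed

lemma Card_order_inj:
  assumes "Card_order r" "|A| \<le>o r"
  obtains p where "inj_on p A" "p ` A \<subseteq> Field r"
proof -
  have "|A| \<le>o |Field r|"
    by (rule ordLeq_ordIso_trans[OF assms(2) ordIso_symmetric[OF card_of_Field_ordIso[OF assms(1)]]])
  then obtain p where "inj_on p A" "p ` A \<subseteq> Field r"
    unfolding card_of_ordLeq[symmetric] by (elim exE conjE)
  then show thesis by (rule that)
qed

lemma card_of_seg:
  assumes r: "Card_order r" and s: "Card_order s" and le: "s \<le>o r"
  shows "|seg r s| =o s"
proof -
  have wo: "Well_order r" "Well_order s"
    using r s by (auto simp: card_order_on_def)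
  have "Refl r" using wo by (simp add: order_on_defs)
  then have "Field (Restr r (seg r s)) = seg r s"
    using Refl_Field_Restr2[of r "seg r s"] by (auto simp: seg_def)
  then have "|seg r s| =o |Field s|"
    using card_of_cong[OF seg_ordIso[OF wo le]] by simp
  then show ?thesis using card_of_Field_ordIso[OF s] by (rule ordIso_transitive)
qed

lemma seg_subset: "seg r s \<subseteq> Field r"
  by (auto simp: seg_def)

lemma card_of_underS_cardSuc:
  assumes "Card_order r" "b \<in> Field (cardSuc r)"
  shows "|underS (cardSuc r) b| \<le>o r"
  using cardSuc_ordLeq_ordLess[OF assms(1) card_of_Card_order]
    card_of_underS[OF cardSuc_Card_order[OF assms(1)] assms(2)] by blast

text \<open>An infinite cardinal has no last element, so the closed segment below \<open>a\<close>
  lies in the open segment below some larger \<open>b\<close>.\<close>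

lemma card_of_under_infinite:
  assumes "Card_order r" "cinfinite r" "a \<in> Field r"
  shows "|under r a| <o r"
proof -
  obtain b where b: "b \<in> Field r" "a \<noteq> b" "(a, b) \<in> r"
    using infinite_Card_order_limit assms unfolding cinfinite_def by metis
  have "Well_order r" using assms by (simp add: card_order_on_def)
  then have "under r a \<subseteq> underS r b"
    using b unfolding under_def underS_def
    by (auto simp: order_on_defs dest: transD antisymD)
  then show ?thesis
    using card_of_underS[OF assms(1) b(1)] card_of_mono1 ordLeq_ordLess_trans by blast
qed

text \<open>Because \<open>cofinal\<close> demands strictly larger elements, the point refuting it
  has no member of \<open>K\<close> strictly above it; totality turns it into a bound, which may
  itself lie in \<open>K\<close>.\<close>

lemma not_cofinal_bounded:
  assumes "Well_order r" "K \<subseteq> Field r" "\<not> cofinal K r"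
  obtains b where "b \<in> Field r" "\<And>a. a \<in> K \<Longrightarrow> (a, b) \<in> r"
proof -
  have wo: "wo_rel r" using assms(1) by (simp add: wo_rel_def)
  obtain b where b: "b \<in> Field r" "\<forall>a\<in>K. \<not> (b \<noteq> a \<and> (b, a) \<in> r)"
    using assms(3) unfolding cofinal_def by blast
  have "(a, b) \<in> r" if "a \<in> K" for a
    using that b assms(2) wo_rel.TOTALS[OF wo] by (metis subsetD)
  with b(1) that show thesis by blast
qed

lemma regularCard_bounded:
  assumes "Card_order r" "regularCard r" "K \<subseteq> Field r" "|K| <o r"
  obtains b where "b \<in> Field r" "\<And>a. a \<in> K \<Longrightarrow> (a, b) \<in> r"
proof -
  have "\<not> cofinal K r"
    using assms not_ordLess_ordIso unfolding regularCard_def by blast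
  then show thesis
    using not_cofinal_bounded[OF _ assms(3)] assms(1) that by (auto simp: card_order_on_def)
qed

lemma cof_bounded:
  assumes "Card_order r" "cinfinite r" "K \<subseteq> Field r" "|K| <o cof r"
  obtains b where "b \<in> Field r" "\<And>a. a \<in> K \<Longrightarrow> (a, b) \<in> r"
proof -
  have "\<not> cofinal K r"
    using cof_eq[OF assms(1,2)] assms(3,4) not_ordLeq_ordLess by metis
  then show thesis
    using not_cofinal_bounded[OF _ assms(3)] assms(1) that by (auto simp: card_order_on_def)
qed

lemma Card_order_cof:
  assumes "Card_order r" "cinfinite r"
  shows "Card_order (cof r)"
  using cof_eq[OF assms] card_of_Card_order by metis

text \<open>A weak upper bound of \<open>K\<close>, found by induction, is never strictly exceeded.
  This is what makes \<open>cof r\<close> infinite.\<close>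

lemma finite_not_cofinal:
  assumes r: "Card_order r" "cinfinite r" and K: "finite K" "K \<subseteq> Field r"
  shows "\<not> cofinal K r"
proof -
  have wo: "Well_order r" using r by (simp add: card_order_on_def)
  have ne: "Field r \<noteq> {}" using r(2) unfolding cinfinite_def by auto
  have "\<exists>b\<in>Field r. \<forall>a\<in>K. (a, b) \<in> r" using K
  proof (induction K rule: finite_induct)
    case empty
    then show ?case using ne by blast
  next
    case (insert x K)
    then obtain b where b: "b \<in> Field r" "\<forall>a\<in>K. (a, b) \<in> r" by blast
    have "wo_rel r" using wo by (simp add: wo_rel_def)
    then have "(x, b) \<in> r \<or> (b, x) \<in> r" "trans r" "(x, x) \<in> r"
      using wo_rel.TOTALS wo_rel.TRANS insert.prems b(1) by blast+
    then show ?case using b insert.prems by (auto dest: transD)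
  qed
  then obtain b where b: "b \<in> Field r" "\<forall>a\<in>K. (a, b) \<in> r" by blast
  have "antisym r" using wo by (simp add: order_on_defs)
  then show ?thesis using b unfolding cofinal_def by (auto dest: antisymD)
qed

lemma cinfinite_cof:
  assumes "Card_order r" "cinfinite r"
  shows "cinfinite (cof r)"
  using cof_eq[OF assms] finite_not_cofinal[OF assms] unfolding cinfinite_def
  by (metis Field_card_of)

subsection \<open>Families of functions that become disjoint after shrinking\<close>

text \<open>The graph of \<open>f a\<close> is kept from \<open>h a\<close> onwards. The index set
  and the order are separate parameters because \<open>D\<close> is first a subset of \<Lambda>
  carrying the order of \<Lambda>, and later all of \<open>cof \<kappa>\<close>.\<close>

definition separable :: "'d rel \<Rightarrow> 'd set \<Rightarrow> ('u \<Rightarrow> 'd \<Rightarrow> 'v) \<Rightarrow> 'u set \<Rightarrow> bool" where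
  "separable r D f T \<longleftrightarrow>
     (\<exists>h. h ` T \<subseteq> D \<and> (\<forall>a\<in>T. \<forall>a'\<in>T. a \<noteq> a' \<longrightarrow>
        (\<forall>i\<in>D. (h a, i) \<in> r \<longrightarrow> (h a', i) \<in> r \<longrightarrow> f a i \<noteq> f a' i)))"

text \<open>The function \<open>f b\<close> differs from \<open>f a\<close> at every \<open>i \<ge> e b a\<close>; the bound \<open>h b a\<close> is taken above the
  points from which \<open>f a\<close> differs from the fewer than \<open>r\<close> functions \<open>f a'\<close> with \<open>e b a' < e b a\<close>.\<close>

lemma regular_separating_family:
  fixes r :: "'a rel" and R :: "'b rel"
  assumes r: "Card_order r" "regularCard r" "cinfinite r" and R: "Well_order R"
    and small: "\<And>b. b \<in> Field R \<Longrightarrow> |underS R b| \<le>o r"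
  obtains f :: "'b \<Rightarrow> 'a \<Rightarrow> 'a" and e :: "'b \<Rightarrow> 'b \<Rightarrow> 'a" and h :: "'b \<Rightarrow> 'b \<Rightarrow> 'a" where
    "\<And>b i. b \<in> Field R \<Longrightarrow> i \<in> Field r \<Longrightarrow> f b i \<in> Field r"
    "\<And>b. b \<in> Field R \<Longrightarrow> inj_on (e b) (underS R b)"
    "\<And>b a. b \<in> Field R \<Longrightarrow> a \<in> underS R b \<Longrightarrow> e b a \<in> Field r"
    "\<And>b a. b \<in> Field R \<Longrightarrow> a \<in> underS R b \<Longrightarrow> h b a \<in> Field r"
    "\<And>b a a' i. b \<in> Field R \<Longrightarrow> a \<in> underS R b \<Longrightarrow> a' \<in> underS R b \<Longrightarrow> a \<noteq> a' \<Longrightarrow> i \<in> Field r \<Longrightarrow>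
       (h b a, i) \<in> r \<Longrightarrow> (h b a', i) \<in> r \<Longrightarrow> f a i \<noteq> f a' i"
proof -
  have wor: "wo_rel r" and woR: "wo_rel R"
    using r R by (auto simp: card_order_on_def wo_rel_def)
  have trans: "trans r" using wo_rel.TRANS[OF wor] .
  have "\<exists>e. inj_on e (underS R b) \<and> e ` underS R b \<subseteq> Field r" if "b \<in> Field R" for b
    using Card_order_inj[OF r(1) small[OF that]] by metis
  then obtain e where e: "\<And>b. b \<in> Field R \<Longrightarrow> inj_on (e b) (underS R b)"
      "\<And>b. b \<in> Field R \<Longrightarrow> e b ` underS R b \<subseteq> Field r"
    by metis
  have underS_Field: "a \<in> Field R" if "a \<in> underS R b" for a b
    using that unfolding underS_def Field_def by blast
  \<comment> \<open>Recursion along \<open>R\<close>: \<open>g\<close> is an admissible function at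
    \<open>b\<close>, given the earlier ones in \<open>f\<close>. The guard makes the condition
    vacuous off \<open>Field R\<close>, where the recursion still has to pick a value.\<close>
  define P where "P f b g \<longleftrightarrow> (b \<in> Field R \<longrightarrow>
      (\<forall>i\<in>Field r. g i \<in> Field r \<and> (\<forall>a\<in>underS R b. (e b a, i) \<in> r \<longrightarrow> g i \<noteq> f a i)))"
    for f :: "'b \<Rightarrow> 'a \<Rightarrow> 'a" and b and g :: "'a \<Rightarrow> 'a"
  have "\<exists>f. \<forall>b. P f b (f b)"
  proof (rule dependent_wf_choice)
    show "wf (R - Id)" using R by (simp add: well_order_on_def)
    show "P f x g = P f' x g" if "\<And>z. (z, x) \<in> R - Id \<Longrightarrow> f z = f' z" for f f' x g
    proof -
      have "f z = f' z" if "z \<in> underS R x" for z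
        using that \<open>\<And>z. (z, x) \<in> R - Id \<Longrightarrow> f z = f' z\<close> unfolding underS_def by blast
      then show ?thesis unfolding P_def by simp
    qed
    show "\<exists>g. P f b g" for b f
    proof (cases "b \<in> Field R")
      case True
      \<comment> \<open>As \<open>e b\<close> is injective, fewer than \<open>r\<close> earlier
        functions have to be avoided at \<open>i\<close>, so some value remains free.\<close>
      have "\<exists>y. y \<in> Field r \<and> (\<forall>a\<in>underS R b. (e b a, i) \<in> r \<longrightarrow> y \<noteq> f a i)"
        if i: "i \<in> Field r" for i
      proof -
        let ?E = "{a \<in> underS R b. (e b a, i) \<in> r}"
        have "inj_on (e b) ?E" "e b ` ?E \<subseteq> under r i"
          using e(1)[OF True] unfolding under_def by (auto intro: inj_on_subset)
        then have "|?E| \<le>o |under r i|" by (rule card_of_ordLeqI)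
        then have "|(\<lambda>a. f a i) ` ?E| <o r"
          by (rule ordLeq_ordLess_trans[OF ordLeq_transitive[OF card_of_image]
                card_of_under_infinite[OF r(1,3) i]])
        then have less: "|(\<lambda>a. f a i) ` ?E| <o |Field r|"
          by (rule ordLess_ordIso_trans[OF _ ordIso_symmetric[OF card_of_Field_ordIso[OF r(1)]]])
        have "\<not> Field r \<subseteq> (\<lambda>a. f a i) ` ?E"
          using not_ordLess_ordLeq[OF less] card_of_mono1[of "Field r"] by blast
        then show ?thesis by blast
      qed
      then show ?thesis unfolding P_def by metis
    qed (simp add: P_def)
  qed
  then obtain f where P: "\<And>b. P f b (f b)" by blast
  have f: "f b i \<in> Field r" if "b \<in> Field R" "i \<in> Field r" for b i
    using P[of b] that unfolding P_def by blast
  have diff: "f b i \<noteq> f a i" if "b \<in> Field R" "a \<in> underS R b" "i \<in> Field r" "(e b a, i) \<in> r" for a b i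
    using P[of b] that unfolding P_def by blast
  \<comment> \<open>For each \<open>a'\<close> preceding \<open>a\<close> in the enumeration
    \<open>e b\<close>, this collects the point from which \<open>f a\<close> and
    \<open>f a'\<close> differ; the case split finds which of the two was built later. Fewer than
    \<open>r\<close> points occur, so regularity bounds them.\<close>
  define K where "K b a = (\<lambda>a'. if a' \<in> underS R a then e a a' else e a' a) `
      {a' \<in> underS R b. e b a' \<in> underS r (e b a)}" for b a
  have "\<exists>y. y \<in> Field r \<and> (\<forall>x\<in>K b a. (x, y) \<in> r)" if b: "b \<in> Field R" and a: "a \<in> underS R b" for a b
  proof -
    let ?E = "{a' \<in> underS R b. e b a' \<in> underS r (e b a)}"
    have "inj_on (e b) ?E" "e b ` ?E \<subseteq> underS r (e b a)"
      using e(1)[OF b] by (auto intro: inj_on_subset)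
    then have "|?E| \<le>o |underS r (e b a)|" by (rule card_of_ordLeqI)
    moreover have "e b a \<in> Field r" using e(2)[OF b] a by blast
    ultimately have "|K b a| <o r"
      unfolding K_def
      by (rule ordLeq_ordLess_trans[OF ordLeq_transitive[OF card_of_image] card_of_underS[OF r(1)]])
    moreover have "K b a \<subseteq> Field r"
    proof
      fix x assume "x \<in> K b a"
      then obtain a' where a': "a' \<in> underS R b" "e b a' \<in> underS r (e b a)"
          "x = (if a' \<in> underS R a then e a a' else e a' a)"
        unfolding K_def by blast
      have "a' \<noteq> a" using a'(2) unfolding underS_def by blast
      then have "a' \<in> underS R a \<or> a \<in> underS R a'"
        using wo_rel.TOTALS[OF woR] underS_Field a a'(1) unfolding underS_def by blast
      then show "x \<in> Field r"
        using a'(3) e(2) underS_Field a a'(1) by (auto split: if_splits)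
    qed
    ultimately show ?thesis using regularCard_bounded[OF r(1,2)] by metis
  qed
  then obtain h where h: "\<And>b a. b \<in> Field R \<Longrightarrow> a \<in> underS R b \<Longrightarrow> h b a \<in> Field r"
      "\<And>b a x. b \<in> Field R \<Longrightarrow> a \<in> underS R b \<Longrightarrow> x \<in> K b a \<Longrightarrow> (x, h b a) \<in> r"
    by metis
  \<comment> \<open>Of two functions, only the bound of the one enumerated later by
    \<open>e b\<close> matters; the symmetric claim follows by comparing \<open>e b a\<close> with
    \<open>e b a'\<close>.\<close>
  have sep: "f a i \<noteq> f a' i"
    if b: "b \<in> Field R" and a: "a \<in> underS R b" "a' \<in> underS R b" "a \<noteq> a'" and i: "i \<in> Field r"
      and hi: "(h b a, i) \<in> r" and below: "(e b a', e b a) \<in> r" for a a' b i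
  proof -
    have "e b a' \<noteq> e b a" using e(1)[OF b] a by (auto dest: inj_onD)
    then have "(if a' \<in> underS R a then e a a' else e a' a) \<in> K b a"
      unfolding K_def using below a unfolding underS_def by blast
    then have "((if a' \<in> underS R a then e a a' else e a' a), i) \<in> r"
      using h(2)[OF b a(1)] hi trans by (blast dest: transD)
    moreover have "a' \<in> underS R a \<or> a \<in> underS R a'"
      using wo_rel.TOTALS[OF woR] underS_Field a unfolding underS_def by blast
    ultimately show ?thesis
      using diff[of a a' i] diff[of a' a i] underS_Field a i by (auto split: if_splits)
  qed
  show thesis
  proof (rule that[of f e h])
    fix b a a' i
    assume *: "b \<in> Field R" "a \<in> underS R b" "a' \<in> underS R b" "a \<noteq> a'" "i \<in> Field r"
       "(h b a, i) \<in> r" "(h b a', i) \<in> r"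
    have "e b a \<in> Field r" "e b a' \<in> Field r" using e(2) * by blast+
    then have "(e b a, e b a') \<in> r \<or> (e b a', e b a) \<in> r"
      using wo_rel.TOTALS[OF wor] by blast
    then show "f a i \<noteq> f a' i"
      using sep[of b a a' i] sep[of b a' a i] * by metis
  qed (use f e h(1) in blast)+
qed

section \<open>Pigeonhole arguments on cofinal index sets\<close>

text \<open>The disjoint sum stays below \<open>r\<close>, bounds both factors and, if infinite,
  absorbs their product. Thus the bound also holds for singular \<open>r\<close>.\<close>

lemma card_of_Times_ordLess:
  assumes r: "Card_order r" "cinfinite r" and less: "|A| <o r" "|B| <o r"
  shows "|A \<times> B| <o r"
proof -
  have inf: "\<not> finite (Field r)" using r(2) unfolding cinfinite_def .
  have sum: "|A <+> B| <o r"
    by (rule card_of_Plus_ordLess_infinite_Field[OF inf r(1) less])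
  show ?thesis
  proof (cases "finite (A <+> B)")
    case True
    then have "finite (A \<times> B)" by simp
    then show ?thesis by (rule card_of_finite_ordLess[OF _ r])
  next
    case False
    have "|A \<times> B| \<le>o |A <+> B|"
      by (rule card_of_Times_ordLeq_infinite_Field)
        (use False in \<open>auto simp: Field_card_of card_of_Plus1 card_of_Plus2 card_of_card_order_on\<close>)
    then show ?thesis using sum by (rule ordLeq_ordLess_trans)
  qed
qed

text \<open>If every piece \<open>C \<inter> E a\<close> missed some tail, starting at
  \<open>b a\<close> say, then each point of \<open>C\<close> would lie below some
  \<open>b a\<close>, and these at most \<open>|K|\<close> points would be cofinal in
  \<open>D\<close>.\<close>

lemma dense_piece:
  fixes r :: "'d rel"
  assumes r: "Well_order r" and D: "D \<subseteq> Field r" and C: "C \<subseteq> D" "\<forall>d\<in>D. \<exists>c\<in>C. (d, c) \<in> r"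
    and no_small: "\<And>C'. C' \<subseteq> D \<Longrightarrow> \<forall>d\<in>D. \<exists>c\<in>C'. (d, c) \<in> r \<Longrightarrow> \<not> |C'| \<le>o |K|"
    and cover: "\<And>c. c \<in> C \<Longrightarrow> \<exists>a\<in>K. c \<in> E a"
  shows "\<exists>a\<in>K. \<forall>d\<in>D. \<exists>c\<in>C \<inter> E a. (d, c) \<in> r"
proof (rule ccontr)
  have wo: "wo_rel r" using r by (simp add: wo_rel_def)
  assume "\<not> ?thesis"
  then have "\<forall>a\<in>K. \<exists>d. d \<in> D \<and> (\<forall>c\<in>C \<inter> E a. (d, c) \<notin> r)" by blast
  then obtain b where b: "\<And>a. a \<in> K \<Longrightarrow> b a \<in> D" "\<And>a c. a \<in> K \<Longrightarrow> c \<in> C \<inter> E a \<Longrightarrow> (b a, c) \<notin> r"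
    by metis
  have "\<exists>x\<in>b ` K. (d, x) \<in> r" if d: "d \<in> D" for d
  proof -
    obtain c where c: "c \<in> C" "(d, c) \<in> r" using C(2) d by blast
    obtain a where a: "a \<in> K" "c \<in> E a" using cover[OF c(1)] by blast
    have "(b a, c) \<notin> r" using b(2)[OF a(1)] a(2) c(1) by blast
    moreover have "b a \<in> Field r" "c \<in> Field r" using b(1)[OF a(1)] c(1) C(1) D by blast+
    ultimately have "(c, b a) \<in> r" using wo_rel.TOTALS[OF wo] by blast
    then have "(d, b a) \<in> r" using c(2) wo_rel.TRANS[OF wo] by (blast dest: transD)
    then show ?thesis using a(1) by blast
  qed
  then have "\<not> |b ` K| \<le>o |K|" using no_small[of "b ` K"] b(1) by blast
  then show False using card_of_image by blast
qed

text \<open>Pigeonhole: if the members of a family of size \<open>\<kappa>\<^sup>+\<close> took values in a small set cofinally often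
  along a small cofinal set of indices, then shrinking the graphs of \<open>\<kappa>\<close> of them to nonempty disjoint
  sets would be impossible for lack of room.\<close>

lemma separable_not_small:
  fixes \<kappa> :: "'k rel" and r :: "'d rel" and f :: "'u \<Rightarrow> 'd \<Rightarrow> 'v"
  assumes \<kappa>: "Card_order \<kappa>" "cinfinite \<kappa>"
    and U: "\<not> |U| \<le>o \<kappa>"
    and sep: "\<And>T. T \<subseteq> U \<Longrightarrow> |T| \<le>o \<kappa> \<Longrightarrow> separable r D f T"
    and C: "C \<subseteq> D" "|C| <o \<kappa>"
    and V: "\<And>a. a \<in> Field \<kappa> \<Longrightarrow> |V a| <o \<kappa>"
    and dense: "\<And>u. u \<in> U \<Longrightarrow> \<exists>a\<in>Field \<kappa>. \<forall>d\<in>D. \<exists>c\<in>C \<inter> {c. f u c \<in> V a}. (d, c) \<in> r"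
  shows False
proof -
  have inf: "\<not> finite (Field \<kappa>)" using \<kappa>(2) unfolding cinfinite_def .
  obtain g where g: "\<And>u. u \<in> U \<Longrightarrow> g u \<in> Field \<kappa>"
      "\<And>u d. u \<in> U \<Longrightarrow> d \<in> D \<Longrightarrow> \<exists>c\<in>C \<inter> {c. f u c \<in> V (g u)}. (d, c) \<in> r"
    using dense by metis
  \<comment> \<open>Otherwise \<open>U\<close> would be a union of \<kappa> fibres of
    \<open>g\<close>, each of size at most \<kappa>.\<close>
  have "\<exists>a\<in>Field \<kappa>. \<not> |{u \<in> U. g u = a}| \<le>o \<kappa>"
  proof (rule ccontr)
    assume "\<not> ?thesis"
    then have "\<forall>a\<in>Field \<kappa>. |{u \<in> U. g u = a}| \<le>o \<kappa>" by blast
    then have "|\<Union>a\<in>Field \<kappa>. {u \<in> U. g u = a}| \<le>o \<kappa>"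
      by (rule card_of_UNION_ordLeq_infinite_Field[OF inf \<kappa>(1)
            ordIso_imp_ordLeq[OF card_of_Field_ordIso[OF \<kappa>(1)]]])
    moreover have "(\<Union>a\<in>Field \<kappa>. {u \<in> U. g u = a}) = U" using g(1) by blast
    ultimately show False using U by simp
  qed
  then obtain a where a: "a \<in> Field \<kappa>" "\<not> |{u \<in> U. g u = a}| \<le>o \<kappa>" by blast
  have "\<not> |{u \<in> U. g u = a}| \<le>o |Field \<kappa>|"
    using a(2) ordLeq_ordIso_trans[OF _ card_of_Field_ordIso[OF \<kappa>(1)]] by blast
  then have "|Field \<kappa>| \<le>o |{u \<in> U. g u = a}|"
    using ordLeq_total[OF card_of_Well_order card_of_Well_order] by blast
  then obtain T where T: "T \<subseteq> {u \<in> U. g u = a}" "|Field \<kappa>| =o |T|"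
    using internalize_card_of_ordLeq2[of "Field \<kappa>"] by blast
  have T\<kappa>: "|T| =o \<kappa>"
    by (rule ordIso_transitive[OF ordIso_symmetric[OF T(2)] card_of_Field_ordIso[OF \<kappa>(1)]])
  have "separable r D f T" using sep[OF _ ordIso_imp_ordLeq[OF T\<kappa>]] T(1) by blast
  then obtain h where h: "h ` T \<subseteq> D" "\<And>u u' i. u \<in> T \<Longrightarrow> u' \<in> T \<Longrightarrow> u \<noteq> u' \<Longrightarrow>
      i \<in> D \<Longrightarrow> (h u, i) \<in> r \<Longrightarrow> (h u', i) \<in> r \<Longrightarrow> f u i \<noteq> f u' i"
    unfolding separable_def by metis
  have "\<exists>c. c \<in> C \<and> f u c \<in> V a \<and> (h u, c) \<in> r" if "u \<in> T" for u
    using g(2)[of u "h u"] that T(1) h(1) by blast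
  then obtain c where c: "\<And>u. u \<in> T \<Longrightarrow> c u \<in> C \<and> f u (c u) \<in> V a \<and> (h u, c u) \<in> r"
    by metis
  \<comment> \<open>Each \<open>c u\<close> lies beyond \<open>h u\<close>, so a repeated pair would
    be a common point of two of the shrunken graphs.\<close>
  have "inj_on (\<lambda>u. (c u, f u (c u))) T"
    by (rule inj_onI) (metis c h(2) C(1) Pair_inject subsetD)
  moreover have "(\<lambda>u. (c u, f u (c u))) ` T \<subseteq> C \<times> V a" using c by blast
  ultimately have "|T| \<le>o |C \<times> V a|" by (rule card_of_ordLeqI)
  moreover have "|C \<times> V a| <o \<kappa>"
    by (rule card_of_Times_ordLess[OF \<kappa> C(2) V[OF a(1)]])
  ultimately have "|T| <o \<kappa>" by (rule ordLeq_ordLess_trans)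
  then show False using T\<kappa> not_ordLess_ordIso by blast
qed

text \<open>The cofinality of \<open>D\<close> is \<open>cof \<kappa>\<close>: were it larger or
  smaller, some cofinal set of size below \<kappa> would contradict
  \<open>separable_not_small\<close>. The functions are then read along a cofinal map
  \<open>p\<close>.\<close>

lemma separable_cof_index:
  fixes \<kappa> :: "'k rel" and r :: "'d rel" and f :: "'u \<Rightarrow> 'd \<Rightarrow> 'd"
  assumes sing: "singularCard \<kappa>" and r: "Well_order r" and D: "D \<subseteq> Field r" "|D| =o \<kappa>"
    and U: "\<not> |U| \<le>o \<kappa>"
    and f: "\<And>u i. u \<in> U \<Longrightarrow> i \<in> D \<Longrightarrow> f u i \<in> D"
    and sep: "\<And>T. T \<subseteq> U \<Longrightarrow> |T| \<le>o \<kappa> \<Longrightarrow> separable r D f T"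
  shows "\<exists>p. p ` Field (cof \<kappa>) \<subseteq> D \<and>
    (\<forall>T. T \<subseteq> U \<longrightarrow> |T| \<le>o \<kappa> \<longrightarrow> separable (cof \<kappa>) (Field (cof \<kappa>)) (\<lambda>u i. f u (p i)) T)"
proof -
  have \<kappa>: "Card_order \<kappa>" "cinfinite \<kappa>" "cof \<kappa> <o \<kappa>"
    using sing unfolding singularCard_def by auto
  have inf: "\<not> finite (Field \<kappa>)" using \<kappa>(2) unfolding cinfinite_def .
  have wor: "wo_rel r" using r by (simp add: wo_rel_def)
  obtain K where K: "K \<subseteq> Field \<kappa>" "cofinal K \<kappa>" "cof \<kappa> = |K|"
    using cof_eq[OF \<kappa>(1,2)] by metis
  let ?dense = "\<lambda>C. \<forall>d\<in>D. \<exists>c\<in>C. (d, c) \<in> r"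
  have refl_dense: "?dense D" using D(1) wo_rel.TOTALS[OF wor] by blast
  obtain \<phi> where \<phi>: "bij_betw \<phi> (Field \<kappa>) D" using Card_order_bij[OF \<kappa>(1) D(2)] .
  \<comment> \<open>A filtration of \<open>D\<close> by sets of size below \<kappa>, of which those
    indexed by \<open>K\<close> already cover \<open>D\<close>.\<close>
  define V where "V a = \<phi> ` underS \<kappa> a" for a
  have V: "|V a| <o \<kappa>" if "a \<in> Field \<kappa>" for a
    unfolding V_def by (rule ordLeq_ordLess_trans[OF card_of_image card_of_underS[OF \<kappa>(1) that]])
  have VD: "V a \<subseteq> D" if "a \<in> Field \<kappa>" for a
    using \<phi> unfolding V_def bij_betw_def underS_def Field_def by blast
  have cover: "\<exists>a\<in>K. d \<in> V a" if "d \<in> D" for d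
  proof -
    have "d \<in> \<phi> ` Field \<kappa>" using \<phi> that unfolding bij_betw_def by blast
    then obtain x where x: "x \<in> Field \<kappa>" "d = \<phi> x" by blast
    then obtain a where "a \<in> K" "x \<noteq> a" "(x, a) \<in> \<kappa>" using K(2) unfolding cofinal_def by blast
    then show ?thesis using x unfolding V_def underS_def by blast
  qed
  have contra: False if "C \<subseteq> D" "|C| <o \<kappa>"
    "\<And>u. u \<in> U \<Longrightarrow> \<exists>a\<in>Field \<kappa>. ?dense (C \<inter> {c. f u c \<in> V a})" for C
    using separable_not_small[OF \<kappa>(1,2) U sep that(1,2) V that(3)] .
  \<comment> \<open>If not, \<open>dense_piece\<close> makes some \<open>V a\<close> cofinal.
    Applied again, to \<open>V a\<close> split according to the values of \<open>f u\<close>, it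
    shows that \<open>V a\<close> is the small cofinal set excluded by
    \<open>contra\<close>.\<close>
  have "\<exists>C\<subseteq>D. ?dense C \<and> |C| \<le>o |K|"
  proof (rule ccontr)
    assume "\<not> ?thesis"
    then have no_small: "\<And>C. C \<subseteq> D \<Longrightarrow> ?dense C \<Longrightarrow> \<not> |C| \<le>o |K|" by blast
    obtain a where a: "a \<in> K" "?dense (D \<inter> V a)"
      using dense_piece[OF r D(1) order_refl refl_dense no_small cover] by blast
    have Va: "D \<inter> V a = V a" "a \<in> Field \<kappa>" using VD a(1) K(1) by blast+
    have dV: "?dense (V a)" using a(2) unfolding Va(1) .
    have "\<exists>a'\<in>Field \<kappa>. ?dense (V a \<inter> {c. f u c \<in> V a'})" if u: "u \<in> U" for u
    proof -
      have "\<exists>a'\<in>K. c \<in> {c. f u c \<in> V a'}" if "c \<in> V a" for c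
        using cover[OF f[OF u]] that VD[OF Va(2)] by blast
      from dense_piece[OF r D(1) VD[OF Va(2)] dV no_small this]
      show ?thesis using K(1) by blast
    qed
    then show False using contra[OF VD[OF Va(2)] V[OF Va(2)]] by blast
  qed
  then obtain C where C: "C \<subseteq> D" "?dense C" "|C| \<le>o |K|" by blast
  \<comment> \<open>Fewer than \<open>cof \<kappa>\<close> values of \<open>f u\<close> have bounded
    indices, hence lie in a single \<open>V b'\<close>; \<open>b'\<close> is taken strictly above
    the bound because \<open>V\<close> uses open segments.\<close>
  have large: "\<not> |C'| <o |K|" if C': "C' \<subseteq> D" "?dense C'" for C'
  proof
    assume less: "|C'| <o |K|"
    have "\<exists>a\<in>Field \<kappa>. ?dense (C' \<inter> {c. f u c \<in> V a})" if u: "u \<in> U" for u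
    proof -
      have "\<exists>x\<in>Field \<kappa>. f u c = \<phi> x" if "c \<in> C'" for c
        using \<phi> f[OF u] that C'(1) unfolding bij_betw_def by blast
      then obtain x where x: "\<And>c. c \<in> C' \<Longrightarrow> x c \<in> Field \<kappa>" "\<And>c. c \<in> C' \<Longrightarrow> f u c = \<phi> (x c)"
        by metis
      have "|x ` C'| <o cof \<kappa>"
        unfolding K(3) by (rule ordLeq_ordLess_trans[OF card_of_image less])
      moreover have "x ` C' \<subseteq> Field \<kappa>" using x(1) by blast
      ultimately obtain b where b: "b \<in> Field \<kappa>" "\<And>a. a \<in> x ` C' \<Longrightarrow> (a, b) \<in> \<kappa>"
        using cof_bounded[OF \<kappa>(1,2)] by metis
      obtain b' where b': "b' \<in> Field \<kappa>" "b \<noteq> b'" "(b, b') \<in> \<kappa>"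
        using infinite_Card_order_limit[OF \<kappa>(1) inf b(1)] by blast
      have tr: "trans \<kappa>" "antisym \<kappa>"
        using \<kappa>(1) by (auto simp: card_order_on_def order_on_defs)
      have "f u c \<in> V b'" if c: "c \<in> C'" for c
      proof -
        have "(x c, b) \<in> \<kappa>" using b(2) c by blast
        then have "x c \<in> underS \<kappa> b'"
          using b'(2,3) tr unfolding underS_def by (auto dest: transD antisymD)
        then show ?thesis using x(2)[OF c] unfolding V_def by blast
      qed
      then have "C' \<inter> {c. f u c \<in> V b'} = C'" by blast
      then show ?thesis using C'(2) b'(1) by (metis (lifting))
    qed
    then show False using contra[OF C'(1) ordLess_transitive[OF less]] \<kappa>(3) unfolding K(3) by blast
  qed
  have ck: "Card_order (cof \<kappa>)" "cinfinite (cof \<kappa>)"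
    using Card_order_cof cinfinite_cof \<kappa> by blast+
  have "|C| =o cof \<kappa>"
    unfolding K(3) using C(3) large[OF C(1,2)] ordLeq_iff_ordLess_or_ordIso by blast
  then obtain q where q: "bij_betw q (Field (cof \<kappa>)) C" using Card_order_bij[OF ck(1)] by blast
  \<comment> \<open>A closed segment of the enumeration \<open>q\<close> is too short to be cofinal.
    Choosing \<open>p i\<close> above all \<open>q j\<close> with \<open>j\<close> up to
    \<open>i\<close> sends tails of \<open>cof \<kappa>\<close> into tails of
    \<open>D\<close>.\<close>
  have "\<exists>d. d \<in> D \<and> (\<forall>j\<in>under (cof \<kappa>) i. (q j, d) \<in> r)" if i: "i \<in> Field (cof \<kappa>)" for i
  proof -
    have uF: "under (cof \<kappa>) i \<subseteq> Field (cof \<kappa>)" unfolding under_def Field_def by blast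
    then have sub: "q ` under (cof \<kappa>) i \<subseteq> D" using q C(1) unfolding bij_betw_def by blast
    have "|q ` under (cof \<kappa>) i| <o |K|"
      using ordLeq_ordLess_trans[OF card_of_image card_of_under_infinite[OF ck i]] unfolding K(3) .
    then have "\<not> ?dense (q ` under (cof \<kappa>) i)" using large[OF sub] by blast
    then obtain d where d: "d \<in> D" "\<forall>j\<in>under (cof \<kappa>) i. (d, q j) \<notin> r" by blast
    then have "\<forall>j\<in>under (cof \<kappa>) i. (q j, d) \<in> r"
      using sub D(1) wo_rel.TOTALS[OF wor] by blast
    then show ?thesis using d(1) by blast
  qed
  then obtain p where p: "\<And>i. i \<in> Field (cof \<kappa>) \<Longrightarrow> p i \<in> D"
      "\<And>i j. i \<in> Field (cof \<kappa>) \<Longrightarrow> (j, i) \<in> cof \<kappa> \<Longrightarrow> (q j, p i) \<in> r"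
    unfolding under_def by (metis mem_Collect_eq)
  have "separable (cof \<kappa>) (Field (cof \<kappa>)) (\<lambda>u i. f u (p i)) T" if T: "T \<subseteq> U" "|T| \<le>o \<kappa>" for T
  proof -
    obtain h where h: "h ` T \<subseteq> D" "\<And>u u' i. u \<in> T \<Longrightarrow> u' \<in> T \<Longrightarrow> u \<noteq> u' \<Longrightarrow>
        i \<in> D \<Longrightarrow> (h u, i) \<in> r \<Longrightarrow> (h u', i) \<in> r \<Longrightarrow> f u i \<noteq> f u' i"
      using sep[OF T] unfolding separable_def by metis
    have "\<exists>j. j \<in> Field (cof \<kappa>) \<and> (h u, q j) \<in> r" if "u \<in> T" for u
    proof -
      have "h u \<in> D" using h(1) that by blast
      then show ?thesis using C(2) q unfolding bij_betw_def by blast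
    qed
    then obtain h' where h': "\<And>u. u \<in> T \<Longrightarrow> h' u \<in> Field (cof \<kappa>)"
        "\<And>u. u \<in> T \<Longrightarrow> (h u, q (h' u)) \<in> r"
      by metis
    have up: "(h u, p i) \<in> r" if "u \<in> T" "i \<in> Field (cof \<kappa>)" "(h' u, i) \<in> cof \<kappa>" for u i
      using h'(2)[OF that(1)] p(2)[OF that(2,3)] wo_rel.TRANS[OF wor] by (blast dest: transD)
    show ?thesis
      unfolding separable_def
    proof (intro exI[of _ h'] conjI ballI impI)
      show "h' ` T \<subseteq> Field (cof \<kappa>)" using h'(1) by blast
      show "f u (p i) \<noteq> f u' (p i)" if "u \<in> T" "u' \<in> T" "u \<noteq> u'" "i \<in> Field (cof \<kappa>)"
        "(h' u, i) \<in> cof \<kappa>" "(h' u', i) \<in> cof \<kappa>" for u u' i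
        using h(2)[of u u' "p i"] that up p(1) by blast
    qed
  qed
  then show ?thesis using p(1) by blast
qed

subsection \<open>Structures with binary functions\<close>

text \<open>Reduces each use of Chang's Conjecture to sets closed under countably many binary
  functions.\<close>

lemma binary_structure:
  fixes F :: "nat \<Rightarrow> 'a \<Rightarrow> 'a \<Rightarrow> 'a"
  assumes "V \<noteq> {}" "\<And>n x y. x \<in> V \<Longrightarrow> y \<in> V \<Longrightarrow> F n x y \<in> V"
  obtains L and A :: "'a fo_structure" where "is_structure L A" "universe A = V"
    "\<And>B. is_substructure L B A \<Longrightarrow> universe B \<subseteq> V \<and>
       (\<forall>n. \<forall>x\<in>universe B. \<forall>y\<in>universe B. F n x y \<in> universe B)"
proof -
  let ?L = "\<lparr>fun_syms = UNIV, rel_syms = {}, fun_arity = (\<lambda>_. 2), rel_arity = (\<lambda>_. 0)\<rparr>"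
  let ?A = "\<lparr>universe = V, fun_interp = (\<lambda>n xs. F n (hd xs) (last xs)), rel_interp = (\<lambda>_ _. False)\<rparr>"
  have "F n (hd xs) (last xs) \<in> V" if "xs \<in> tuples V 2" for n xs
  proof -
    have "xs \<noteq> []" "set xs \<subseteq> V" using that unfolding tuples_def by auto
    then show ?thesis using assms(2) hd_in_set last_in_set by blast
  qed
  then have "is_structure ?L ?A" using assms(1) unfolding is_structure_def by simp
  moreover have "universe ?A = V" by simp
  moreover have "universe B \<subseteq> V \<and> (\<forall>n. \<forall>x\<in>universe B. \<forall>y\<in>universe B. F n x y \<in> universe B)"
    if B: "is_substructure ?L B ?A" for B
  proof (intro conjI allI ballI)
    show "universe B \<subseteq> V" using B unfolding is_substructure_def by simp
    fix n x y assume "x \<in> universe B" "y \<in> universe B"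
    then have xy: "[x, y] \<in> tuples (universe B) 2" unfolding tuples_def by simp
    have "fun_interp B n [x, y] = F n x y"
      using B xy unfolding is_substructure_def by simp
    moreover have "is_structure ?L B" using B unfolding is_substructure_def by (rule conjunct1)
    then have "fun_interp B n [x, y] \<in> universe B" using xy unfolding is_structure_def by simp
    ultimately show "F n x y \<in> universe B" by simp
  qed
  ultimately show thesis by (rule that)
qed

subsection \<open>Transfer along Chang's Conjecture\<close>

text \<open>Closure under \<open>e\<close> makes the part of \<open>U\<close> below any of its
  members have size at most \<kappa>. Hence subsets of size at most \<kappa> are bounded in
  \<open>U\<close> by some \<open>b\<close>, and closure under \<open>h\<close> puts the separating
  bounds \<open>h b\<close> into \<open>D\<close>. Then \<open>separable_cof_index\<close> replaces
  \<open>D\<close> by \<open>cof \<kappa>\<close>.\<close>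

lemma chang_separable_family:
  fixes \<kappa> :: "'k rel" and \<Lambda> :: "'l rel"
  assumes sing: "singularCard \<kappa>" and \<Lambda>: "Card_order \<Lambda>" "regularCard \<Lambda>" and less: "\<kappa> <o \<Lambda>"
    and chang: "chang (cardSuc \<Lambda>) \<Lambda> (cardSuc \<kappa>) \<kappa>"
  obtains g :: "'k set \<Rightarrow> 'k \<Rightarrow> 'k" where
    "\<And>x i. x \<in> Field (cardSuc \<kappa>) \<Longrightarrow> i \<in> Field (cof \<kappa>) \<Longrightarrow> g x i \<in> Field \<kappa>"
    "\<And>T. T \<subseteq> Field (cardSuc \<kappa>) \<Longrightarrow> |T| \<le>o \<kappa> \<Longrightarrow> separable (cof \<kappa>) (Field (cof \<kappa>)) g T"
proof -
  have \<kappa>: "Card_order \<kappa>" "cinfinite \<kappa>" using sing unfolding singularCard_def by auto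
  have inf: "\<not> finite (Field \<kappa>)" using \<kappa>(2) unfolding cinfinite_def .
  have \<Lambda>inf: "cinfinite \<Lambda>" using cinfinite_mono[OF \<kappa>(2,1) \<Lambda>(1) ordLess_imp_ordLeq[OF less]] .
  let ?R = "cardSuc \<Lambda>"
  let ?S = "seg ?R \<Lambda>"
  have R: "Well_order ?R" using cardSuc_Well_order[OF \<Lambda>(1)] .
  have woR: "wo_rel ?R" using R by (simp add: wo_rel_def)
  have wo\<Lambda>: "Well_order \<Lambda>" using \<Lambda>(1) by (simp add: card_order_on_def)
  obtain f e h where
    f: "\<And>b i. b \<in> Field ?R \<Longrightarrow> i \<in> Field \<Lambda> \<Longrightarrow> f b i \<in> Field \<Lambda>" and
    e: "\<And>b. b \<in> Field ?R \<Longrightarrow> inj_on (e b) (underS ?R b)"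
      "\<And>b a. b \<in> Field ?R \<Longrightarrow> a \<in> underS ?R b \<Longrightarrow> e b a \<in> Field \<Lambda>" and
    h: "\<And>b a. b \<in> Field ?R \<Longrightarrow> a \<in> underS ?R b \<Longrightarrow> h b a \<in> Field \<Lambda>"
      "\<And>b a a' i. b \<in> Field ?R \<Longrightarrow> a \<in> underS ?R b \<Longrightarrow> a' \<in> underS ?R b \<Longrightarrow> a \<noteq> a' \<Longrightarrow>
         i \<in> Field \<Lambda> \<Longrightarrow> (h b a, i) \<in> \<Lambda> \<Longrightarrow> (h b a', i) \<in> \<Lambda> \<Longrightarrow> f a i \<noteq> f a' i"
  proof (rule regular_separating_family[OF \<Lambda> \<Lambda>inf R card_of_underS_cardSuc[OF \<Lambda>(1)]], goal_cases)
    case (1 b) show ?case by (rule 1(2))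
  next
    case (2 f e h) show ?case by (rule that[OF 2(2-6)])
  qed
  have "|?S| =o \<Lambda>"
    by (rule card_of_seg[OF cardSuc_Card_order[OF \<Lambda>(1)] \<Lambda>(1) cardSuc_ordLeq[OF \<Lambda>(1)]])
  then obtain s where s: "bij_betw s (Field \<Lambda>) ?S" using Card_order_bij[OF \<Lambda>(1)] by blast
  let ?t = "inv_into (Field \<Lambda>) s"
  have sS: "s i \<in> ?S" if "i \<in> Field \<Lambda>" for i using s that unfolding bij_betw_def by blast
  have tF: "?t x \<in> Field \<Lambda>" if "x \<in> ?S" for x
    using s that unfolding bij_betw_def by (metis inv_into_into)
  have ts: "?t (s i) = i" if "i \<in> Field \<Lambda>" for i using s that unfolding bij_betw_def by simp
  \<comment> \<open>The codes 0 and 1 stand for \<open>f\<close> and \<open>e\<close>, all others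
    for \<open>h\<close>, with \<Lambda> identified with \<open>?S\<close> through \<open>s\<close>.
    Off the intended domain the value is the argument \<open>x\<close>, so closure there demands
    nothing.\<close>
  define F where "F n b x =
      (if n = 0 then if x \<in> ?S then s (f b (?t x)) else x
       else if n = 1 then if x \<in> underS ?R b then s (e b x) else x
       else if x \<in> underS ?R b then s (h b x) else x)" for n :: nat and b x
  have "F n b x \<in> Field ?R" if "b \<in> Field ?R" "x \<in> Field ?R" for n b x
    using that f e(2) h(1) tF sS seg_subset[of ?R \<Lambda>] unfolding F_def by (auto 0 3)
  moreover have "Field ?R \<noteq> {}" by (rule Field_cardSuc_not_empty[OF \<Lambda>(1)])
  ultimately obtain L A where A: "is_structure L A" "universe A = Field ?R"
    "\<And>B. is_substructure L B A \<Longrightarrow> universe B \<subseteq> Field ?R \<and>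
       (\<forall>n. \<forall>x\<in>universe B. \<forall>y\<in>universe B. F n x y \<in> universe B)"
    using binary_structure[of "Field ?R" F] by metis
  obtain B where B: "is_substructure L B A" "|universe B| =o cardSuc \<kappa>" "|universe B \<inter> ?S| =o \<kappa>"
    using chang A(1,2) unfolding chang_def by blast
  define U where "U = universe B"
  have U: "U \<subseteq> Field ?R" "|U| =o cardSuc \<kappa>" "|U \<inter> ?S| =o \<kappa>"
      "\<And>n x y. x \<in> U \<Longrightarrow> y \<in> U \<Longrightarrow> F n x y \<in> U"
    using A(3)[OF B(1)] B unfolding U_def by auto
  define D where "D = {i \<in> Field \<Lambda>. s i \<in> U}"
  have D: "D \<subseteq> Field \<Lambda>" unfolding D_def by blast
  have "bij_betw s D (U \<inter> ?S)"
  proof (rule bij_betw_subset[OF s D])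
    show "s ` D = U \<inter> ?S"
    proof
      show "s ` D \<subseteq> U \<inter> ?S" using sS unfolding D_def by blast
      show "U \<inter> ?S \<subseteq> s ` D"
      proof
        fix x assume x: "x \<in> U \<inter> ?S"
        then have "s (?t x) = x" using s unfolding bij_betw_def by (metis IntD2 f_inv_into_f)
        moreover have "?t x \<in> Field \<Lambda>" using tF x by blast
        ultimately show "x \<in> s ` D" using x unfolding D_def by (metis (lifting) IntD1 image_eqI mem_Collect_eq)
      qed
    qed
  qed
  then have "|D| =o |U \<inter> ?S|" using card_of_ordIso by blast
  then have D\<kappa>: "|D| =o \<kappa>" by (rule ordIso_transitive[OF _ U(3)])
  have large: "\<not> |U| \<le>o \<kappa>"
  proof
    assume "|U| \<le>o \<kappa>"
    then have "cardSuc \<kappa> \<le>o \<kappa>" by (rule ordIso_ordLeq_trans[OF ordIso_symmetric[OF U(2)]])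
    then show False using cardSuc_greater[OF \<kappa>(1)] not_ordLess_ordLeq by blast
  qed
  have fD: "f u i \<in> D" if "u \<in> U" "i \<in> D" for u i
  proof -
    have i: "i \<in> Field \<Lambda>" "s i \<in> U" using that(2) unfolding D_def by auto
    have "F 0 u (s i) = s (f u i)" using sS[OF i(1)] ts[OF i(1)] unfolding F_def by simp
    then show ?thesis using U(4)[OF that(1) i(2), of 0] f U(1) that(1) i(1) unfolding D_def by auto
  qed
  have eD: "e u a \<in> D" if "u \<in> U" "a \<in> U \<inter> underS ?R u" for u a
    using U(4)[of u a 1] e(2)[of u a] that U(1) unfolding D_def F_def by auto
  have hD: "h u a \<in> D" if "u \<in> U" "a \<in> U \<inter> underS ?R u" for u a
    using U(4)[of u a 2] h(1)[of u a] that U(1) unfolding D_def F_def by auto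
  have below: "|U \<inter> underS ?R u| \<le>o \<kappa>" if u: "u \<in> U" for u
  proof -
    have "inj_on (e u) (U \<inter> underS ?R u)"
      using e(1)[of u] u U(1) by (meson inf_le2 inj_on_subset subsetD)
    moreover have "e u ` (U \<inter> underS ?R u) \<subseteq> D" using eD[OF u] by blast
    ultimately have "|U \<inter> underS ?R u| \<le>o |D|" by (rule card_of_ordLeqI)
    then show ?thesis by (rule ordLeq_ordIso_trans[OF _ D\<kappa>])
  qed
  \<comment> \<open>Otherwise each member of \<open>U\<close> is in \<open>T\<close> or below a
    member of \<open>T\<close>, which leaves \<open>U\<close> with at most \<kappa>
    elements.\<close>
  have bounded: "\<exists>b\<in>U. T \<subseteq> underS ?R b" if T: "T \<subseteq> U" "|T| \<le>o \<kappa>" for T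
  proof (rule ccontr)
    assume unb: "\<not> ?thesis"
    have "U \<subseteq> T \<union> (\<Union>t\<in>T. U \<inter> underS ?R t)"
    proof
      fix b assume b: "b \<in> U"
      then obtain t where t: "t \<in> T" "t \<notin> underS ?R b" using unb by blast
      then have "t = b \<or> b \<in> underS ?R t"
        using wo_rel.TOTALS[OF woR] T(1) b U(1) unfolding underS_def by blast
      then show "b \<in> T \<union> (\<Union>t\<in>T. U \<inter> underS ?R t)" using t(1) b by blast
    qed
    then have "|U| \<le>o |T \<union> (\<Union>t\<in>T. U \<inter> underS ?R t)|" by (rule card_of_mono1)
    moreover have "|\<Union>t\<in>T. U \<inter> underS ?R t| \<le>o \<kappa>"
      using below T(1) by (intro card_of_UNION_ordLeq_infinite_Field[OF inf \<kappa>(1) T(2)]) blast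
    then have "|T \<union> (\<Union>t\<in>T. U \<inter> underS ?R t)| \<le>o \<kappa>"
      by (rule card_of_Un_ordLeq_infinite_Field[OF inf T(2) _ \<kappa>(1)])
    ultimately have "|U| \<le>o \<kappa>" by (rule ordLeq_transitive)
    then show False using large by blast
  qed
  have sep: "separable \<Lambda> D f T" if T: "T \<subseteq> U" "|T| \<le>o \<kappa>" for T
  proof -
    obtain b where b: "b \<in> U" "T \<subseteq> underS ?R b" using bounded[OF T] by blast
    have bR: "b \<in> Field ?R" using b(1) U(1) by blast
    show ?thesis
      unfolding separable_def
    proof (intro exI[of _ "h b"] conjI ballI impI)
      show "h b ` T \<subseteq> D" using hD[OF b(1)] b(2) T(1) by blast
      show "f a i \<noteq> f a' i" if "a \<in> T" "a' \<in> T" "a \<noteq> a'" "i \<in> D" "(h b a, i) \<in> \<Lambda>" "(h b a', i) \<in> \<Lambda>"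
        for a a' i
        using h(2)[OF bR] that b(2) D by blast
    qed
  qed
  obtain p where p: "p ` Field (cof \<kappa>) \<subseteq> D"
    "\<And>T. T \<subseteq> U \<Longrightarrow> |T| \<le>o \<kappa> \<Longrightarrow> separable (cof \<kappa>) (Field (cof \<kappa>)) (\<lambda>u i. f u (p i)) T"
    using separable_cof_index[OF sing wo\<Lambda> D D\<kappa> large fD sep] by metis
  obtain \<phi> where \<phi>: "bij_betw \<phi> (Field \<kappa>) D" using Card_order_bij[OF \<kappa>(1) D\<kappa>] .
  obtain \<psi> where \<psi>: "bij_betw \<psi> (Field (cardSuc \<kappa>)) U"
    using Card_order_bij[OF cardSuc_Card_order[OF \<kappa>(1)] U(2)] .
  define g where "g x i = inv_into (Field \<kappa>) \<phi> (f (\<psi> x) (p i))" for x i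
  have fp: "f (\<psi> x) (p i) \<in> D" if "x \<in> Field (cardSuc \<kappa>)" "i \<in> Field (cof \<kappa>)" for x i
    using fD p(1) \<psi> that unfolding bij_betw_def by blast
  show thesis
  proof (rule that[of g])
    show "g x i \<in> Field \<kappa>" if "x \<in> Field (cardSuc \<kappa>)" "i \<in> Field (cof \<kappa>)" for x i
      using fp[OF that] \<phi> unfolding g_def bij_betw_def by (metis inv_into_into)
    show "separable (cof \<kappa>) (Field (cof \<kappa>)) g T" if T: "T \<subseteq> Field (cardSuc \<kappa>)" "|T| \<le>o \<kappa>" for T
    proof -
      have "\<psi> ` T \<subseteq> U" using \<psi> T(1) unfolding bij_betw_def by blast
      moreover have "|\<psi> ` T| \<le>o \<kappa>" by (rule ordLeq_transitive[OF card_of_image T(2)])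
      ultimately obtain k where k: "k ` \<psi> ` T \<subseteq> Field (cof \<kappa>)"
        "\<And>u u' i. u \<in> \<psi> ` T \<Longrightarrow> u' \<in> \<psi> ` T \<Longrightarrow> u \<noteq> u' \<Longrightarrow> i \<in> Field (cof \<kappa>) \<Longrightarrow>
          (k u, i) \<in> cof \<kappa> \<Longrightarrow> (k u', i) \<in> cof \<kappa> \<Longrightarrow> f u (p i) \<noteq> f u' (p i)"
        using p(2)[of "\<psi> ` T"] unfolding separable_def by metis
      show ?thesis
        unfolding separable_def
      proof (intro exI[of _ "\<lambda>x. k (\<psi> x)"] conjI ballI impI)
        show "(\<lambda>x. k (\<psi> x)) ` T \<subseteq> Field (cof \<kappa>)" using k(1) by blast
        fix x x' i
        assume *: "x \<in> T" "x' \<in> T" "x \<noteq> x'" and i: "i \<in> Field (cof \<kappa>)"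
          and le: "(k (\<psi> x), i) \<in> cof \<kappa>" "(k (\<psi> x'), i) \<in> cof \<kappa>"
        have "\<psi> x \<noteq> \<psi> x'" using * \<psi> T(1) unfolding bij_betw_def by (meson inj_onD subsetD)
        then have "f (\<psi> x) (p i) \<noteq> f (\<psi> x') (p i)" using k(2) * i le by blast
        moreover have "inj_on (inv_into (Field \<kappa>) \<phi>) D"
          using \<phi> unfolding bij_betw_def by (metis inj_on_inv_into order_refl)
        moreover have "f (\<psi> x) (p i) \<in> D" "f (\<psi> x') (p i) \<in> D" using fp i * T(1) by blast+
        ultimately show "g x i \<noteq> g x' i" unfolding g_def by (meson inj_onD)
      qed
    qed
  qed
qed

section \<open>Closed subsets of \<open>cardSuc \<kappa>\<close> and their traces on
  \<open>cof \<kappa>\<close>\<close>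

text \<open>Both clauses rest on one fact: the trace \<open>X\<close> of \<open>M\<close> on
  \<open>cof \<kappa>\<close> is bounded. So \<open>M\<close> omits a point of the copy of
  \<open>cof \<kappa>\<close>, and members of \<open>M\<close> are coded by functions on a proper
  initial segment.\<close>

lemma closed_sets_refuted:
  fixes \<kappa> :: "'k rel" and \<mu> :: "'m rel" and g :: "'k set \<Rightarrow> 'k \<Rightarrow> 'k"
  assumes \<kappa>: "Card_order \<kappa>" "cinfinite \<kappa>" "cof \<kappa> <o \<kappa>"
    and \<mu>: "Card_order \<mu>" "cof \<kappa> \<le>o \<mu>" "\<mu> <o \<kappa>"
    and g: "\<And>x i. x \<in> Field (cardSuc \<kappa>) \<Longrightarrow> i \<in> Field (cof \<kappa>) \<Longrightarrow> g x i \<in> Field \<kappa>"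
    and sep: "\<And>T. T \<subseteq> Field (cardSuc \<kappa>) \<Longrightarrow> |T| \<le>o \<kappa> \<Longrightarrow>
      separable (cof \<kappa>) (Field (cof \<kappa>)) g T"
  obtains F :: "nat \<Rightarrow> 'k set \<Rightarrow> 'k set \<Rightarrow> 'k set" where
    "\<And>n x y. x \<in> Field (cardSuc \<kappa>) \<Longrightarrow> y \<in> Field (cardSuc \<kappa>) \<Longrightarrow> F n x y \<in> Field (cardSuc \<kappa>)"
    "\<And>M. M \<subseteq> Field (cardSuc \<kappa>) \<Longrightarrow> \<forall>n. \<forall>x\<in>M. \<forall>y\<in>M. F n x y \<in> M \<Longrightarrow> |M| =o cardSuc \<mu> \<Longrightarrow>
      |M \<inter> seg (cardSuc \<kappa>) \<kappa>| =o \<mu> \<Longrightarrow>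
      \<not> seg (cardSuc \<kappa>) (cof \<kappa>) \<subseteq> M \<and> \<not> weak_cexp \<mu> (cof \<kappa>) =o \<mu>"
proof -
  let ?R = "cardSuc \<kappa>" and ?c = "cof \<kappa>"
  have ck: "Card_order ?c" "cinfinite ?c" using Card_order_cof cinfinite_cof \<kappa> by blast+
  have woc: "wo_rel ?c" using ck(1) by (simp add: card_order_on_def wo_rel_def)
  have \<mu>inf: "cinfinite \<mu>" by (rule cinfinite_mono[OF ck(2,1) \<mu>(1,2)])
  have inf: "\<not> finite (Field \<kappa>)" "\<not> finite (Field \<mu>)"
    using \<kappa>(2) \<mu>inf unfolding cinfinite_def by auto
  have cR: "?c \<le>o ?R"
    by (rule ordLeq_transitive[OF ordLess_imp_ordLeq[OF \<kappa>(3)] cardSuc_ordLeq[OF \<kappa>(1)]])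
  let ?S = "seg ?R \<kappa>" and ?W = "seg ?R ?c"
  obtain s where s: "bij_betw s (Field \<kappa>) ?S"
    by (rule Card_order_bij[OF \<kappa>(1) card_of_seg[OF cardSuc_Card_order[OF \<kappa>(1)] \<kappa>(1) cardSuc_ordLeq[OF \<kappa>(1)]]])
  obtain w where w: "bij_betw w (Field ?c) ?W"
    by (rule Card_order_bij[OF ck(1) card_of_seg[OF cardSuc_Card_order[OF \<kappa>(1)] ck(1) cR]])
  let ?w' = "inv_into (Field ?c) w"
  have wW: "w i \<in> ?W" if "i \<in> Field ?c" for i using w that unfolding bij_betw_def by blast
  have w'w: "?w' (w i) = i" if "i \<in> Field ?c" for i using w that unfolding bij_betw_def by simp
  have w'F: "?w' x \<in> Field ?c" if "x \<in> ?W" for x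
    using w that unfolding bij_betw_def by (metis inv_into_into)
  have sS: "s i \<in> ?S" if "i \<in> Field \<kappa>" for i using s that unfolding bij_betw_def by blast
  have sinj: "i = j" if "s i = s j" "i \<in> Field \<kappa>" "j \<in> Field \<kappa>" for i j
    using s that unfolding bij_betw_def by (meson inj_onD)
  \<comment> \<open>By separability of the pair \<open>{x, y}\<close>, the two functions differ at
    the larger of its two bounds.\<close>
  have "\<exists>i. i \<in> Field ?c \<and> g x i \<noteq> g y i"
    if xy: "x \<in> Field ?R" "y \<in> Field ?R" "x \<noteq> y" for x y
  proof -
    have "|{x, y}| \<le>o \<kappa>"
      by (rule ordLess_imp_ordLeq[OF card_of_finite_ordLess[OF _ \<kappa>(1,2)]]) simp
    then have "separable ?c (Field ?c) g {x, y}" using sep[of "{x, y}"] xy by blast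
    then obtain h where "h ` {x, y} \<subseteq> Field ?c" "\<forall>a\<in>{x, y}. \<forall>a'\<in>{x, y}. a \<noteq> a' \<longrightarrow>
        (\<forall>i\<in>Field ?c. (h a, i) \<in> ?c \<longrightarrow> (h a', i) \<in> ?c \<longrightarrow> g a i \<noteq> g a' i)"
      unfolding separable_def by (elim exE conjE)
    then have h: "h x \<in> Field ?c" "h y \<in> Field ?c"
      "\<And>i. i \<in> Field ?c \<Longrightarrow> (h x, i) \<in> ?c \<Longrightarrow> (h y, i) \<in> ?c \<Longrightarrow> g x i \<noteq> g y i"
      using xy(3) by simp_all
    have "(h x, h y) \<in> ?c \<or> (h y, h x) \<in> ?c" "(h x, h x) \<in> ?c" "(h y, h y) \<in> ?c"
      using wo_rel.TOTALS[OF woc] h(1,2) by blast+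
    then show ?thesis using h by blast
  qed
  then obtain d where d: "\<And>x y. x \<in> Field ?R \<Longrightarrow> y \<in> Field ?R \<Longrightarrow> x \<noteq> y \<Longrightarrow>
      d x y \<in> Field ?c \<and> g x (d x y) \<noteq> g y (d x y)"
    by metis
  \<comment> \<open>\<open>?W\<close> is the copy of \<open>cof \<kappa>\<close> inside \<open>\<kappa>\<^sup>+\<close>, identified through \<open>w\<close>.\<close>
  define F where "F n x y =
      (if n = 0 then if y \<in> ?W then s (g x (?w' y)) else y
       else if x \<noteq> y then w (d x y) else y)" for n :: nat and x y
  have F: "F n x y \<in> Field ?R" if "x \<in> Field ?R" "y \<in> Field ?R" for n x y
    using that g w'F sS wW d seg_subset unfolding F_def by (metis subsetD)
  show thesis
  proof (rule that[of F, OF F], goal_cases)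
    case (1 n x y) then show ?case by simp
  next
    case (2 n x y) then show ?case by simp
  next
    case M: (3 M)
    have large: "\<not> |M| \<le>o \<mu>"
    proof
      assume "|M| \<le>o \<mu>"
      then have "cardSuc \<mu> \<le>o \<mu>" by (rule ordIso_ordLeq_trans[OF ordIso_symmetric[OF M(3)]])
      then show False using cardSuc_greater[OF \<mu>(1)] not_ordLess_ordLeq by blast
    qed
    define X where "X = {i \<in> Field ?c. w i \<in> M}"
    have gM: "s (g x i) \<in> M \<inter> ?S" if "x \<in> M" "i \<in> X" for x i
    proof -
      have i: "i \<in> Field ?c" "w i \<in> M" using that(2) unfolding X_def by auto
      have "F 0 x (w i) = s (g x i)" using wW[OF i(1)] w'w[OF i(1)] unfolding F_def by simp
      then have "s (g x i) \<in> M" using M(2) that(1) i(2) by metis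
      moreover have "g x i \<in> Field \<kappa>" using g M(1) that(1) i(1) by blast
      ultimately show ?thesis using sS by blast
    qed
    have dX: "d x y \<in> X" if "x \<in> M" "y \<in> M" "x \<noteq> y" for x y
    proof -
      have "F 1 x y = w (d x y)" using that(3) unfolding F_def by simp
      then have "w (d x y) \<in> M" using M(2) that(1,2) by metis
      then show ?thesis using d M(1) that unfolding X_def by blast
    qed
    have gF: "g x i \<in> Field \<kappa>" if "x \<in> M" "i \<in> X" for x i
      using g M(1) that unfolding X_def by blast
    \<comment> \<open>Since \<mu> is below \<kappa>, \<open>M\<close> itself has size at most
      \<kappa> and is separable. With \<open>X\<close> cofinal, a point \<open>k x\<close> of
      \<open>X\<close> beyond each \<open>h x\<close> would inject \<open>M\<close> into a product
      of size at most \<mu>.\<close>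
    have not_dense: "\<exists>a\<in>Field ?c. \<forall>i\<in>X. (a, i) \<notin> ?c"
    proof (rule ccontr)
      assume "\<not> ?thesis"
      then have dense: "\<And>a. a \<in> Field ?c \<Longrightarrow> \<exists>i\<in>X. (a, i) \<in> ?c" by blast
      have "|M| \<le>o \<kappa>"
        by (rule ordIso_ordLeq_trans[OF M(3) cardSuc_least[OF \<mu>(1) \<kappa>(1) \<mu>(3)]])
      then obtain h where h: "h ` M \<subseteq> Field ?c" "\<And>x y i. x \<in> M \<Longrightarrow> y \<in> M \<Longrightarrow> x \<noteq> y \<Longrightarrow>
          i \<in> Field ?c \<Longrightarrow> (h x, i) \<in> ?c \<Longrightarrow> (h y, i) \<in> ?c \<Longrightarrow> g x i \<noteq> g y i"
        using sep[OF M(1)] unfolding separable_def by metis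
      have "\<exists>i\<in>X. (h x, i) \<in> ?c" if "x \<in> M" for x using dense h(1) that by blast
      then obtain k where k: "\<And>x. x \<in> M \<Longrightarrow> k x \<in> X" "\<And>x. x \<in> M \<Longrightarrow> (h x, k x) \<in> ?c" by metis
      have "inj_on (\<lambda>x. (k x, s (g x (k x)))) M"
      proof (rule inj_onI, rule ccontr)
        fix x y assume xy: "x \<in> M" "y \<in> M" "(k x, s (g x (k x))) = (k y, s (g y (k y)))" "x \<noteq> y"
        have kk: "k y = k x"
          using xy(3) unfolding prod.inject by (elim conjE) (rule sym)
        have "s (g x (k x)) = s (g y (k x))"
          using xy(3) unfolding prod.inject kk by (rule conjunct2)
        then have "g x (k x) = g y (k x)"
          by (rule sinj[OF _ gF[OF xy(1) k(1)[OF xy(1)]] gF[OF xy(2) k(1)[OF xy(1)]]])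
        moreover have "k x \<in> Field ?c" using k(1)[OF xy(1)] unfolding X_def by blast
        ultimately show False
          using h(2)[OF xy(1,2,4), of "k x"] k(2)[OF xy(1)] k(2)[OF xy(2)] unfolding kk by blast
      qed
      moreover have "(\<lambda>x. (k x, s (g x (k x)))) ` M \<subseteq> Field ?c \<times> (M \<inter> ?S)"
      proof
        fix v assume "v \<in> (\<lambda>x. (k x, s (g x (k x)))) ` M"
        then obtain x where x: "x \<in> M" "v = (k x, s (g x (k x)))" by (rule imageE)
        have "k x \<in> Field ?c" using k(1)[OF x(1)] unfolding X_def by simp
        then show "v \<in> Field ?c \<times> (M \<inter> ?S)"
          unfolding x(2) using gM[OF x(1) k(1)[OF x(1)]] by (rule SigmaI)
      qed
      ultimately have "|M| \<le>o |Field ?c \<times> (M \<inter> ?S)|" by (rule card_of_ordLeqI)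
      moreover have "|Field ?c \<times> (M \<inter> ?S)| \<le>o \<mu>"
        by (rule card_of_Times_ordLeq_infinite_Field[OF inf(2)
              ordIso_ordLeq_trans[OF card_of_Field_ordIso[OF ck(1)] \<mu>(2)] ordIso_imp_ordLeq[OF M(4)] \<mu>(1)])
      ultimately have "|M| \<le>o \<mu>" by (rule ordLeq_transitive)
      then show False using large by blast
    qed
    then obtain a where a: "a \<in> Field ?c" "\<And>i. i \<in> X \<Longrightarrow> (a, i) \<notin> ?c" by blast
    have "a \<notin> X" using a wo_rel.TOTALS[OF woc] by blast
    then have "\<not> ?W \<subseteq> M" using wW[OF a(1)] a(1) unfolding X_def by blast
    moreover have "\<not> weak_cexp \<mu> ?c =o \<mu>"
    proof
      assume weak: "weak_cexp \<mu> ?c =o \<mu>"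
      have Xa: "X \<subseteq> underS ?c a"
      proof
        fix i assume i: "i \<in> X"
        then have "i \<in> Field ?c" "i \<noteq> a" using \<open>a \<notin> X\<close> unfolding X_def by auto
        then show "i \<in> underS ?c a"
          using a(2)[OF i] a(1) wo_rel.TOTALS[OF woc] unfolding underS_def by blast
      qed
      obtain \<theta> where \<theta>: "inj_on \<theta> (M \<inter> ?S)" "\<theta> ` (M \<inter> ?S) \<subseteq> Field \<mu>"
        by (rule Card_order_inj[OF \<mu>(1) ordIso_imp_ordLeq[OF M(4)]])
      obtain z where z: "z \<in> Field \<mu>" using inf(2) by (metis finite.emptyI ex_in_conv)
      \<comment> \<open>The value \<open>z\<close> is an arbitrary filler on the rest of the segment
        below \<open>a\<close>; beyond it \<open>Func\<close> requires
        \<open>undefined\<close>.\<close>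
      define G where "G x i = (if i \<in> X then \<theta> (s (g x i))
          else if i \<in> underS ?c a then z else undefined)" for x i
      \<comment> \<open>The length tag \<open>a\<close> is constant. Closure of \<open>M\<close>
        puts \<open>d x y\<close> into \<open>X\<close>, where \<open>G\<close> still records the
        values of \<open>g\<close>.\<close>
      have "inj_on (\<lambda>x. (a, G x)) M"
      proof (rule inj_onI, rule ccontr)
        fix x y assume xy: "x \<in> M" "y \<in> M" "(a, G x) = (a, G y)" "x \<noteq> y"
        let ?i = "d x y"
        have i: "?i \<in> X" by (rule dX[OF xy(1,2,4)])
        have "G x ?i = G y ?i" using xy(3) by simp
        then have "\<theta> (s (g x ?i)) = \<theta> (s (g y ?i))" using i unfolding G_def by simp
        then have "s (g x ?i) = s (g y ?i)"
          using \<theta>(1) gM[OF xy(1) i] gM[OF xy(2) i] by (meson inj_onD)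
        then have "g x ?i = g y ?i" using sinj gF[OF xy(1) i] gF[OF xy(2) i] by blast
        then show False using d xy(1,2,4) M(1) by blast
      qed
      moreover have "G x \<in> Func (underS ?c a) (Field \<mu>)" if "x \<in> M" for x
        using gM[OF that] \<theta>(2) z Xa unfolding Func_def G_def by auto
      then have "(\<lambda>x. (a, G x)) ` M \<subseteq> (SIGMA b : Field ?c. Func (underS ?c b) (Field \<mu>))"
        using a(1) by blast
      ultimately have "|M| \<le>o weak_cexp \<mu> ?c" unfolding weak_cexp_def by (rule card_of_ordLeqI)
      then have "|M| \<le>o \<mu>" by (rule ordLeq_ordIso_trans[OF _ weak])
      then show False using large by blast
    qed
    ultimately show ?case by blast
  qed
qed

theorem theorem2p7:
  fixes \<kappa> :: "'k rel" and \<Lambda> :: "'l rel" and \<mu> :: "'m rel"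
  assumes "singularCard \<kappa>"
    and "Card_order \<Lambda>" and "regularCard \<Lambda>" and "\<kappa> <o \<Lambda>"
    and "chang (cardSuc \<Lambda>) \<Lambda> (cardSuc \<kappa>) \<kappa>"
    and "Card_order \<mu>" and "cof \<kappa> \<le>o \<mu>" and "\<mu> <o \<kappa>"
  shows "\<not> chang_over (cof \<kappa>) (cardSuc \<kappa>) \<kappa> (cardSuc \<mu>) \<mu> \<and>
         (weak_cexp \<mu> (cof \<kappa>) =o \<mu> \<longrightarrow> \<not> chang (cardSuc \<kappa>) \<kappa> (cardSuc \<mu>) \<mu>)"
proof -
  have \<kappa>: "Card_order \<kappa>" "cinfinite \<kappa>" "cof \<kappa> <o \<kappa>"
    using assms(1) unfolding singularCard_def by auto
  let ?V = "Field (cardSuc \<kappa>)"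
  obtain g :: "'k set \<Rightarrow> 'k \<Rightarrow> 'k" where g:
    "\<And>x i. x \<in> ?V \<Longrightarrow> i \<in> Field (cof \<kappa>) \<Longrightarrow> g x i \<in> Field \<kappa>"
    "\<And>T. T \<subseteq> ?V \<Longrightarrow> |T| \<le>o \<kappa> \<Longrightarrow> separable (cof \<kappa>) (Field (cof \<kappa>)) g T"
  proof (rule chang_separable_family[OF assms(1-5)], goal_cases)
    case (1 g) show ?case by (rule that[OF 1(2-3)])
  qed
  obtain F where F: "\<And>n x y. x \<in> ?V \<Longrightarrow> y \<in> ?V \<Longrightarrow> F n x y \<in> ?V"
    "\<And>M. M \<subseteq> ?V \<Longrightarrow> \<forall>n::nat. \<forall>x\<in>M. \<forall>y\<in>M. F n x y \<in> M \<Longrightarrow> |M| =o cardSuc \<mu> \<Longrightarrow>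
      |M \<inter> seg (cardSuc \<kappa>) \<kappa>| =o \<mu> \<Longrightarrow>
      \<not> seg (cardSuc \<kappa>) (cof \<kappa>) \<subseteq> M \<and> \<not> weak_cexp \<mu> (cof \<kappa>) =o \<mu>"
  proof (rule closed_sets_refuted[OF \<kappa> assms(6-8) g], goal_cases)
    case (5 F) show ?case by (rule that[OF 5(2-3)])
  qed
  obtain L A where A: "is_structure L A" "universe A = ?V"
    "\<And>B. is_substructure L B A \<Longrightarrow> universe B \<subseteq> ?V \<and>
       (\<forall>n. \<forall>x\<in>universe B. \<forall>y\<in>universe B. F n x y \<in> universe B)"
  proof (rule binary_structure[of ?V F, OF Field_cardSuc_not_empty[OF \<kappa>(1)] F(1)], goal_cases)
    case (3 L A) show ?case by (rule that[OF 3(2-4)])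
  qed
  \<comment> \<open>One structure refutes both principles: the first conjunct excludes the required
    inclusion, the second contradicts the weak power hypothesis.\<close>
  have key: "\<not> seg (cardSuc \<kappa>) (cof \<kappa>) \<subseteq> universe B \<and> \<not> weak_cexp \<mu> (cof \<kappa>) =o \<mu>"
    if "is_substructure L B A" "|universe B| =o cardSuc \<mu>"
      "|universe B \<inter> seg (cardSuc \<kappa>) \<kappa>| =o \<mu>" for B
    using F(2)[OF _ _ that(2,3)] A(3)[OF that(1)] by blast
  then show ?thesis using A(1,2) unfolding chang_over_def chang_def by blast
qed

end
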